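(* Let $(\alpha_n)_n,(\gamma_n)_n,(C_n)_n,(r_n)_n$ be real sequences with $\alpha_n\in(0,1]$, $\gamma_n\ge1$, $C_n\ge1$, $r_n>0$ for all $n$, and $\alpha_n,\gamma_n,C_n\to1$, $r_n\to0$ as $n\to\infty$. Let $(X,d)$ be a separable, directionally limited metric space endowed with a sequence of measures $(\nu_n)_n$ such that $\nu_n$ is asymptotically $(\alpha_n,\gamma_n)$-bounded for each $n$. Let $\mu$ be a positive Borel measure on $X$ and let $q$ be a premeasure defined on the closed balls of $X$ satisfying $$C_n^{-1}\mu(B_{\alpha_n r}(x))\le q(B_r(x))\le C_n\,\mu(B_r(x))$$ for all $x\in X$, $n\in\mathbb N$ and $r\in(0,r_n)$. Let $\hat\mu^q$ be obtained from $q$ by the packing construction. Then $\hat\mu^q=\mu$ (as measures on Borel sets).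
   Context: Balls: $B_r(x)=\{y\in X: d(x,y)\le r\}$ is the closed ball and $U_r(x)=\{y\in X: d(x,y)<r\}$ the open ball, $r>0$. Directionally limited: let $\xi>0$, $0<\eta\le\frac13$, $\zeta\in\{1,2,\dots\}$ and $A\subset X$. The distance $d$ is directionally $(\xi,\eta,\zeta)$-limited at $A$ if, for every $a\in A$ and every $B\subset A\cap(U_\xi(a)\setminus\{a\})$ with the property that for all $b,c\in B$ with $b\ne c$ and $d(a,b)\ge d(a,c)$ and all $x\in X$ with $d(a,x)=d(a,c)$ and $d(a,x)+d(x,b)=d(a,b)$ one has $\frac{d(x,c)}{d(a,c)}\ge\eta$, it holds that $\operatorname{card}B\le\zeta$. $(X,d)$ is directionally limited if $d$ is directionally $(\xi,\eta,\zeta)$-limited at $X$ for some such $(\xi,\eta,\zeta)$. Asymptotically $(\alpha,\gamma)$-bounded measure: a positive Borel measure $\nu$ on $X$ that is finite on bounded sets, strictly positive on every ball of positive radius, and such that $\limsup_{r\to0^+}\frac{\nu(B_r(x))}{\nu(B_{\alpha r}(x))}\le\gamma$ for all $x\in X$. Premeasure: a nonnegative (possibly $+\infty$-valued) function $q$ defined on the family of closed balls of $X$ together with $\emptyset$, with $q(\emptyset)=0$. Packing construction: for $U\subset X$ open and $\delta>0$, a packing of $U$ of order $\delta$ is a countable family of pairwise disjoint closed balls of radius less than $\delta$ whose union is contained in $U$. Set $\hat\mu^q_\delta(U)=\sup\{\sum_{B\in\mathcal F}q(B): \mathcal F\text{ is a packing of }U\text{ of order }\delta\}$, $\hat\mu^q(U)=\lim_{\delta\to0}\hat\mu^q_\delta(U)=\inf_{\delta>0}\hat\mu^q_\delta(U)$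 for $U$ open, and $\hat\mu^q(A)=\inf\{\hat\mu^q(U): A\subset U,\ U\text{ open}\}$ for every $A\subset X$.
   Formalization: The positive Borel measure μ is additionally assumed locally finite (each point has an open neighbourhood of finite measure); without this the claim fails, e.g. for counting measure of the rationals on the real line with q infinite on all balls. *)

theory Defs
  imports "HOL-Analysis.Analysis"
begin

(* card of an infinite set is 0, so "card B <= zeta" must include finiteness of B. *)
definition directionally_limited_at ::
  "real \<Rightarrow> real \<Rightarrow> nat \<Rightarrow> 'a::metric_space set \<Rightarrow> bool" where
  "directionally_limited_at \<xi> \<eta> \<zeta> A \<longleftrightarrow>
     (\<forall>a\<in>A. \<forall>B. B \<subseteq> A \<inter> (ball a \<xi> - {a}) \<and>
        (\<forall>b\<in>B. \<forall>c\<in>B. b \<noteq> c \<and> dist a b \<ge> dist a c \<longrightarrow>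
           (\<forall>x. dist a x = dist a c \<and> dist a x + dist x b = dist a b \<longrightarrow>
              dist x c / dist a c \<ge> \<eta>))
        \<longrightarrow> finite B \<and> card B \<le> \<zeta>)"

definition directionally_limited :: "'a::metric_space itself \<Rightarrow> bool" where
  "directionally_limited _ \<longleftrightarrow>
     (\<exists>\<xi> \<eta> \<zeta>. \<xi> > 0 \<and> 0 < \<eta> \<and> \<eta> \<le> 1/3 \<and> \<zeta> \<ge> 1 \<and>
        directionally_limited_at \<xi> \<eta> \<zeta> (UNIV :: 'a set))"

definition asymptotically_bounded_measure ::
  "real \<Rightarrow> real \<Rightarrow> 'a::metric_space measure \<Rightarrow> bool" where
  "asymptotically_bounded_measure \<alpha> \<gamma> \<nu> \<longleftrightarrow>
     sets \<nu> = sets borel \<and>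
     (\<forall>A\<in>sets borel. bounded A \<longrightarrow> emeasure \<nu> A < \<infinity>) \<and>
     (\<forall>x r. r > 0 \<longrightarrow> emeasure \<nu> (cball x r) > 0) \<and>
     (\<forall>x. Limsup (at_right 0)
             (\<lambda>r. emeasure \<nu> (cball x r) / emeasure \<nu> (cball x (\<alpha> * r))) \<le> ennreal \<gamma>)"

(* Without local finiteness the measure need not be outer regular, whereas the packing construction
   always is: the counting measure of the rationals, with q infinite on every ball of the line,
   is not recovered. *)
definition locally_finite_measure :: "'a::metric_space measure \<Rightarrow> bool" where
  "locally_finite_measure \<mu> \<longleftrightarrow> (\<forall>x. \<exists>U. open U \<and> x \<in> U \<and> emeasure \<mu> U < \<infinity>)"

(* A premeasure is a function of the ball as a set, not of a centre and a radius.  It is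
   represented by a total function on sets, of which only the values on closed balls of positive
   radius and on the empty set are ever used. *)
definition premeasure :: "('a::metric_space set \<Rightarrow> ennreal) \<Rightarrow> bool" where
  "premeasure q \<longleftrightarrow> q {} = 0"

(* A ball may have several radii (and centres); "of radius less than delta" asks for one of them
   to be less than delta. Disjoint balls of positive radius are distinct sets, so families and
   sets of balls agree. *)
definition packing :: "'a::metric_space set \<Rightarrow> real \<Rightarrow> 'a set set \<Rightarrow> bool" where
  "packing U \<delta> \<F> \<longleftrightarrow>
     countable \<F> \<and> disjoint \<F> \<and> (\<forall>B\<in>\<F>. \<exists>x r. 0 < r \<and> r < \<delta> \<and> B = cball x r) \<and> \<Union>\<F> \<subseteq> U"

definition packing_premeasure ::
  "('a::metric_space set \<Rightarrow> ennreal) \<Rightarrow> real \<Rightarrow> 'a set \<Rightarrow> ennreal" where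
  "packing_premeasure q \<delta> U = (SUP \<F>\<in>{\<F>. packing U \<delta> \<F>}. \<Sum>\<^sub>\<infinity>B\<in>\<F>. q B)"

definition packing_open ::
  "('a::metric_space set \<Rightarrow> ennreal) \<Rightarrow> 'a set \<Rightarrow> ennreal" where
  "packing_open q U = (INF \<delta>\<in>{0<..}. packing_premeasure q \<delta> U)"

definition packing_measure ::
  "('a::metric_space set \<Rightarrow> ennreal) \<Rightarrow> 'a set \<Rightarrow> ennreal" where
  "packing_measure q A = (INF U\<in>{U. open U \<and> A \<subseteq> U}. packing_open q U)"

lemma packing_premeasure_mono:
  assumes "\<delta> \<le> \<delta>'" "U \<subseteq> V"
  shows "packing_premeasure q \<delta> U \<le> packing_premeasure q \<delta>' V"
  unfolding packing_premeasure_def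
proof (rule SUP_subset_mono)
  have "packing V \<delta>' \<F>" if "packing U \<delta> \<F>" for \<F>
    using that assms unfolding packing_def by (meson less_le_trans subset_trans)
  then show "{\<F>. packing U \<delta> \<F>} \<subseteq> {\<F>. packing V \<delta>' \<F>}" by blast
qed simp

lemma packing_premeasure_tendsto:
  "((\<lambda>\<delta>. packing_premeasure q \<delta> U) \<longlongrightarrow> packing_open q U) (at_right 0)"
proof (rule order_tendstoI)
  fix a assume a: "a < packing_open q U"
  have "a < packing_premeasure q \<delta> U" if "0 < \<delta>" for \<delta>
    using a that unfolding packing_open_def by (auto intro: less_le_trans INF_lower)
  then show "\<forall>\<^sub>F \<delta> in at_right 0. a < packing_premeasure q \<delta> U"
    by (auto simp: eventually_at_right_field intro!: exI[of _ 1])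
next
  fix a assume "packing_open q U < a"
  then obtain \<delta> where \<delta>: "\<delta> > 0" "packing_premeasure q \<delta> U < a"
    unfolding packing_open_def by (auto simp: INF_less_iff)
  then show "\<forall>\<^sub>F \<delta> in at_right 0. packing_premeasure q \<delta> U < a"
    by (auto simp: eventually_at_right_field intro!: exI[of _ \<delta>]
        intro: le_less_trans[OF packing_premeasure_mono[OF less_imp_le order_refl]])
qed

lemma packing_measure_open:
  assumes "open U"
  shows "packing_measure q U = packing_open q U"
proof (rule antisym)
  show "packing_measure q U \<le> packing_open q U"
    unfolding packing_measure_def using assms by (auto intro: INF_lower)
  show "packing_open q U \<le> packing_measure q U"
    unfolding packing_measure_def packing_open_def
    by (intro INF_greatest INF_mono) (auto intro: packing_premeasure_mono)
qed

end

theory Submission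
  imports Defs
begin

text \<open>
  The upper bound is the comparison of \<open>q\<close> with \<open>\<mu>\<close> on disjoint balls, together with outer regularity
  of \<open>\<mu>\<close>. For the lower bound on an open set \<open>U\<close>, directional limitedness bounds the number of
  earlier (larger) balls that a ball of a greedily chosen cover can meet, so a bounded number of
  disjoint subfamilies covers \<open>U\<close>, one of which carries a fixed fraction of \<open>\<mu> U\<close>; iterating on the open
  remainder exhausts \<open>U\<close>. This Vitali argument is applied to balls that satisfy one of
  \<open>\<mu> (B\<^sub>r) \<le> (\<gamma> + \<epsilon>) \<mu> (B\<^sub>\<alpha>\<^sub>r)\<close> and \<open>\<mu> (B\<^sub>r) \<le> \<epsilon> \<nu> (B\<^sub>r)\<close>. Every centre admits arbitrarily small such
  balls: if both failed at all small radii, then along the radii \<open>\<alpha>\<^sup>k r\<close> the measure \<open>\<mu>\<close> would decay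
  geometrically faster than \<open>\<nu>\<close>, contradicting \<open>\<epsilon> \<nu> < \<mu>\<close>. Balls of the
  second kind
  contribute at most \<open>\<epsilon> \<nu> U\<close>.
\<close>

section \<open>Covering by balls of bounded overlap\<close>

text \<open>\<open>E\<close> stands for the centres of earlier balls that meet the ball about
  \<open>a\<close>. Let \<open>b\<close>, \<open>c\<close> lie in one class with \<open>c\<close> no
  farther from \<open>a\<close>. A point \<open>x\<close> as in the definition of directional
  limitation has \<open>dist x b = dist a b - dist a c\<close>, so \<open>dist x c\<close> is at
  least \<open>dist b c\<close> minus that difference. Within a class this stays above
  \<open>dist a c / 3\<close>; since \<eta> \<le> 1/3, each class has at most \<zeta>
  members.\<close>

lemma directional_count:
  fixes a :: "'a::metric_space"
  assumes lim: "directionally_limited_at \<xi> \<eta> \<zeta> (UNIV :: 'a set)" and \<eta>: "\<eta> \<le> 1/3"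
    and ra: "r a > 0"
    and E1: "\<And>b. b \<in> E \<Longrightarrow> 0 < r b \<and> r b < dist a b \<and> dist a b \<le> r a + r b \<and> r a \<le> 7/6 * r b \<and> r a + r b < \<xi>"
    and E2: "\<And>b c. b \<in> E \<Longrightarrow> c \<in> E \<Longrightarrow> b \<noteq> c \<Longrightarrow>
       r b < dist b c \<and> r c \<le> 7/6 * r b \<or> r c < dist b c \<and> r b \<le> 7/6 * r c"
  shows "finite E \<and> card E \<le> 14 * \<zeta>"
proof -
  \<comment> \<open>Far centres form one class; near centres are split into annuli around \<open>a\<close> of width \<open>r a / 6\<close>.\<close>
  define cls where "cls b = (if dist a b > 2 * r a then 13 else nat \<lfloor>6 * dist a b / r a\<rfloor>)" for b
  define F where "F i = {b\<in>E. cls b = i}" for i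
  have cls13: "cls b \<le> 13" for b
  proof (cases "dist a b > 2 * r a")
    case False
    then have "6 * dist a b / r a \<le> 12" using ra by (simp add: field_simps)
    then have "nat \<lfloor>6 * dist a b / r a\<rfloor> \<le> 12" by linarith
    then show ?thesis using False by (simp add: cls_def)
  qed (simp add: cls_def)
  have F: "finite (F i) \<and> card (F i) \<le> \<zeta>" for i
  proof -
    have "F i \<subseteq> UNIV \<inter> (ball a \<xi> - {a})"
      using E1 by (fastforce simp: F_def)
    moreover have "dist x c / dist a c \<ge> \<eta>"
      if b: "b \<in> F i" and c: "c \<in> F i" and bc: "b \<noteq> c" "dist a b \<ge> dist a c"
        and x: "dist a x = dist a c" "dist a x + dist x b = dist a b" for b c x
    proof -
      have bE: "b \<in> E" and cE: "c \<in> E" and cl: "cls b = cls c" using b c by (auto simp: F_def)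
      note e = E1[OF bE] E1[OF cE] E2[OF bE cE bc(1)]
      have tri: "dist x c \<ge> dist b c - dist a b + dist a c"
        using dist_triangle[of b c x] x by (simp add: dist_commute)
      \<comment> \<open>If \<open>c\<close> is far, \<open>dist x c\<close> is at least
        \<open>dist a c - r a\<close> minus a loss of at most \<open>r c / 6 < dist a c / 6\<close>
        from the radius ratio; as \<open>r a < dist a c / 2\<close>, what remains is 5/6 - 1/2 = 1/3
        of \<open>dist a c\<close>. This is where the ratio 7/6 comes from.\<close>
      have "dist x c \<ge> dist a c / 3"
      proof (cases "dist a c > 2 * r a")
        case True
        then show ?thesis using e tri by linarith
      next
        case False
        then have "cls c \<noteq> 13"
        proof -
          have "6 * dist a c / r a \<le> 12" using ra False by (simp add: field_simps)
          then have "nat \<lfloor>6 * dist a c / r a\<rfloor> \<le> 12" by linarith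
          then show ?thesis using False by (simp add: cls_def)
        qed
        then have nb: "\<not> dist a b > 2 * r a" using cl by (auto simp: cls_def)
        have "nat \<lfloor>6 * dist a b / r a\<rfloor> = nat \<lfloor>6 * dist a c / r a\<rfloor>"
          using cl False nb by (simp add: cls_def)
        moreover have "0 \<le> 6 * dist a b / r a" "0 \<le> 6 * dist a c / r a" using ra by auto
        ultimately have "6 * dist a b / r a < 6 * dist a c / r a + 1" by linarith
        then have "6 * dist a b < 6 * dist a c + r a" using ra by (simp add: field_simps)
        \<comment> \<open>A common annulus gives \<open>dist a b - dist a c < r a / 6\<close>, while
          \<open>dist b c\<close> exceeds a radius that is at least \<open>6/7 * r a\<close>. Now
          6/7 - 1/6 > 2/3 and \<open>dist a c \<le> 2 * r a\<close>.\<close>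
        then show ?thesis using e tri False by linarith
      qed
      moreover have "dist a c > 0" using e by linarith
      moreover have "\<eta> * dist a c \<le> 1/3 * dist a c" using \<eta> by (intro mult_right_mono) auto
      ultimately have "dist a c > 0" "\<eta> * dist a c \<le> dist x c" by linarith+
      then show ?thesis by (simp only: pos_le_divide_eq)
    qed
    ultimately show ?thesis
      by (intro lim[unfolded directionally_limited_at_def, rule_format, of a "F i"]) simp_all
  qed
  \<comment> \<open>There are fourteen classes: 0 to 12 are near (12 only at distance exactly
    \<open>2 * r a\<close>) and 13 is far.\<close>
  have E: "E = (\<Union>i\<in>{..13}. F i)" using cls13 by (auto simp: F_def)
  have "card (\<Union>i\<in>{..13}. F i) \<le> (\<Sum>i\<in>{..13}. card (F i))" by (rule card_UN_le) simp
  also have "\<dots> \<le> (\<Sum>i\<in>{..13::nat}. \<zeta>)" using F by (intro sum_mono) auto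
  finally show ?thesis using E F by simp
qed

text \<open>Membership of \<open>x\<close> depends only on its \<open>R\<close>-predecessors, so
  well-founded recursion performs the greedy selection without an enumeration of \<open>U\<close>,
  which may be uncountable.\<close>

lemma wf_greedy_set:
  assumes "wf R"
  obtains S where "\<And>x. x \<in> S \<longleftrightarrow> x \<in> U \<and> (\<forall>y. (y, x) \<in> R \<and> y \<in> S \<longrightarrow> P y x)"
proof -
  define S where "S = wfrec R (\<lambda>f x. x \<in> U \<and> (\<forall>y. (y, x) \<in> R \<and> f y \<longrightarrow> P y x))"
  have *: "S x \<longleftrightarrow> x \<in> U \<and> (\<forall>y. (y, x) \<in> R \<and> S y \<longrightarrow> P y x)" for x
    by (subst S_def, subst wfrec[OF assms]) (auto simp: S_def cut_apply)
  show thesis by (rule that[of "{x. S x}"], unfold mem_Collect_eq, rule *)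
qed

text \<open>First-fit colouring: at most \<open>M\<close> earlier neighbours cannot block all
  \<open>M + 1\<close> colours from 0 to \<open>M\<close>.\<close>

lemma wf_greedy_colouring:
  assumes "wf R" and fin: "\<And>x. x \<in> S \<Longrightarrow> finite {y\<in>S. (y, x) \<in> R \<and> Q y x} \<and> card {y\<in>S. (y, x) \<in> R \<and> Q y x} \<le> M"
  obtains c :: "'a \<Rightarrow> nat" where "\<And>x. x \<in> S \<Longrightarrow> c x \<le> M"
    and "\<And>x y. x \<in> S \<Longrightarrow> y \<in> S \<Longrightarrow> (y, x) \<in> R \<Longrightarrow> Q y x \<Longrightarrow> c x \<noteq> c y"
proof -
  define N where "N x = {y\<in>S. (y, x) \<in> R \<and> Q y x}" for x
  define c where "c = wfrec R (\<lambda>f x. LEAST n::nat. n \<notin> f ` N x)"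
  have c: "c x = (LEAST n. n \<notin> c ` N x)" for x
  proof -
    have "cut c R x ` N x = c ` N x" by (intro image_cong) (auto simp: N_def cut_apply)
    then show ?thesis unfolding c_def by (subst wfrec[OF assms(1)]) simp
  qed
  have ex: "\<exists>n\<le>M. n \<notin> c ` N x" if "x \<in> S" for x
  proof (rule ccontr)
    assume "\<not> ?thesis"
    then have "{..M} \<subseteq> c ` N x" by auto
    moreover have "finite (N x)" "card (N x) \<le> M" using fin[OF that] by (auto simp: N_def)
    ultimately have "card {..M} \<le> M"
      by (meson card_image_le card_mono finite_imageI order_trans)
    then show False by simp
  qed
  show thesis
  proof (rule that[of c])
    fix x assume x: "x \<in> S"
    then obtain n where n: "n \<le> M" "n \<notin> c ` N x" using ex by blast
    then show "c x \<le> M" by (subst c) (meson Least_le order_trans)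
    fix y assume "y \<in> S" "(y, x) \<in> R" "Q y x"
    then have "y \<in> N x" by (simp add: N_def)
    moreover have "c x \<notin> c ` N x" by (subst c) (rule LeastI[of "\<lambda>n. n \<notin> c ` N x", OF n(2)])
    ultimately show "c x \<noteq> c y" by auto
  qed
qed

lemma dense_dist:
  fixes D :: "'a::metric_space set"
  assumes "closure D = UNIV" "e > 0"
  shows "\<exists>d\<in>D. dist x d < e"
proof -
  have "x \<in> closure D" by (simp add: assms(1))
  then show ?thesis using assms(2) unfolding closure_approachable by (simp add: dist_commute)
qed

text \<open>Points of \<open>D\<close> closer than \<open>e / 2\<close> to distinct points of
  \<open>S\<close> are distinct, which injects \<open>S\<close> into \<open>D\<close>.\<close>

lemma countable_separated:
  fixes S D :: "'a::metric_space set"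
  assumes D: "countable D" "closure D = UNIV"
    and e: "e > 0" and sep: "\<And>x y. x \<in> S \<Longrightarrow> y \<in> S \<Longrightarrow> x \<noteq> y \<Longrightarrow> dist x y > e"
  shows "countable S"
proof -
  have "\<forall>x. \<exists>d\<in>D. dist x d < e / 2" using dense_dist[OF D(2) half_gt_zero[OF e]] by blast
  then obtain f where f: "\<And>x. f x \<in> D" "\<And>x. dist x (f x) < e / 2" by metis
  have "inj_on f S"
  proof (rule inj_onI, rule ccontr)
    fix x y assume "x \<in> S" "y \<in> S" "f x = f y" "x \<noteq> y"
    then show False
      using sep[of x y] f(2)[of x] f(2)[of y] dist_triangle2[of x y "f x"] by simp
  qed
  moreover have "countable (f ` S)" using f(1) D(1) by (meson countable_subset image_subsetI)
  ultimately show ?thesis by (rule countable_image_inj_on[rotated])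
qed

text \<open>Centres are selected greedily, larger radii first, and a point is rejected only if an
  earlier selected ball contains it; hence the selected balls cover \<open>U\<close>. By
  \<open>directional_count\<close> each of them meets at most \<open>14 * \<zeta>\<close> earlier
  ones, so colouring by first fit splits them into disjoint subfamilies.\<close>

lemma besicovitch_covering:
  fixes r :: "'a::metric_space \<Rightarrow> real" and D U :: "'a set"
  assumes lim: "directionally_limited_at \<xi> \<eta> \<zeta> (UNIV :: 'a set)" and \<eta>: "\<eta> \<le> 1/3"
    and D: "countable D" "closure D = (UNIV :: 'a set)"
    and r: "\<And>x. x \<in> U \<Longrightarrow> 0 < r x \<and> r x < \<xi> / 2"
  obtains S and c :: "'a \<Rightarrow> nat" where "S \<subseteq> U" "countable S" "U \<subseteq> (\<Union>x\<in>S. cball x (r x))"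
    "\<And>x. x \<in> S \<Longrightarrow> c x \<le> 14 * \<zeta>"
    "\<And>x y. x \<in> S \<Longrightarrow> y \<in> S \<Longrightarrow> x \<noteq> y \<Longrightarrow> c x = c y \<Longrightarrow> cball x (r x) \<inter> cball y (r y) = {}"
proof -
  obtain W where W: "well_order_on (UNIV :: 'a set) W" using well_order_on by blast
  then have wfW: "wf (W - Id)" and totW: "total_on UNIV W"
    by (auto simp: well_order_on_def linear_order_on_def)
  \<comment> \<open>Layers of radii whose ratio is at most \<open>7/6\<close>; larger radii come first.\<close>
  define key where "key x = nat \<lfloor>log (7/6) (\<xi> / r x)\<rfloor>" for x
  \<comment> \<open>The well-order \<open>W\<close> breaks ties inside a layer, which makes
    \<open>R\<close> total on distinct points as well as well-founded.\<close>
  define R where "R = inv_image (less_than <*lex*> (W - Id)) (\<lambda>x. (key x, x))"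
  have wfR: "wf R" unfolding R_def using wfW by (intro wf_inv_image wf_lex_prod) auto
  have tot: "(x, y) \<in> R \<or> (y, x) \<in> R" if "x \<noteq> y" for x y
    using totW that unfolding R_def total_on_def by auto
  \<comment> \<open>Both logarithms are nonnegative because the radii lie below \<xi>, so
    \<open>nat\<close> truncates nothing, and ordered floors mean that the logarithm for
    \<open>y\<close> exceeds that for \<open>x\<close> by less than 1.\<close>
  have rR: "r x \<le> 7/6 * r y" if "(y, x) \<in> R" "x \<in> U" "y \<in> U" for x y
  proof -
    have k: "key y \<le> key x" using that by (auto simp: R_def)
    have pos: "\<xi> / r x \<ge> 1" "\<xi> / r y \<ge> 1" "\<xi> > 0" using r[of x] r[of y] that by auto
    then have "log (7/6) (\<xi> / r x) \<ge> 0" "log (7/6) (\<xi> / r y) \<ge> 0" by auto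
    then have "log (7/6) (\<xi> / r y) < log (7/6) (\<xi> / r x) + 1"
      using k unfolding key_def by linarith
    also have "\<dots> = log (7/6) (7/6 * (\<xi> / r x))" using pos by (subst log_mult) auto
    finally have "\<xi> / r y < 7/6 * (\<xi> / r x)" using pos by (subst (asm) log_less_cancel_iff) auto
    then show ?thesis using pos r[of x] r[of y] that by (simp add: field_simps)
  qed
  obtain S where S: "\<And>x. x \<in> S \<longleftrightarrow> x \<in> U \<and> (\<forall>y. (y, x) \<in> R \<and> y \<in> S \<longrightarrow> dist y x > r y)"
    using wf_greedy_set[OF wfR, of U "\<lambda>y x. dist y x > r y"] by blast
  have SU: "S \<subseteq> U" using S by blast
  have sep: "r x < dist x y \<and> r y \<le> 7/6 * r x \<or> r y < dist x y \<and> r x \<le> 7/6 * r y"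
    if "x \<in> S" "y \<in> S" "x \<noteq> y" for x y
    using tot[OF that(3)] S[of x] S[of y] that rR[of x y] rR[of y x] by (auto simp: dist_commute)
  \<comment> \<open>Two selected centres are farther apart than one of their radii, so a lower bound
    on the radii is a separation constant.\<close>
  have "countable {x\<in>S. r x > 1 / real (Suc n)}" for n
  proof (rule countable_separated[OF D])
    show "0 < 1 / real (Suc n)" by simp
    show "1 / real (Suc n) < dist x y"
      if "x \<in> {x\<in>S. r x > 1 / real (Suc n)}" "y \<in> {x\<in>S. r x > 1 / real (Suc n)}" "x \<noteq> y" for x y
      using sep[of x y] that by auto
  qed
  then have "countable (\<Union>n. {x\<in>S. r x > 1 / real (Suc n)})" by blast
  moreover have "S \<subseteq> (\<Union>n. {x\<in>S. r x > 1 / real (Suc n)})"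
  proof
    fix x assume x: "x \<in> S"
    then have "r x > 0" using r SU by blast
    then obtain n where "1 / real (Suc n) < r x" using nat_approx_posE by blast
    then show "x \<in> (\<Union>n. {x\<in>S. r x > 1 / real (Suc n)})" using x by auto
  qed
  ultimately have cS: "countable S" by (rule countable_subset[rotated])
  have cov: "U \<subseteq> (\<Union>x\<in>S. cball x (r x))"
  proof
    fix x assume x: "x \<in> U"
    show "x \<in> (\<Union>x\<in>S. cball x (r x))"
    proof (cases "x \<in> S")
      case True
      then show ?thesis using r[OF x] by force
    next
      case False
      then show ?thesis using S[of x] x by (force simp: not_less)
    qed
  qed
  have "finite {y\<in>S. (y, x) \<in> R \<and> cball y (r y) \<inter> cball x (r x) \<noteq> {}} \<and>
        card {y\<in>S. (y, x) \<in> R \<and> cball y (r y) \<inter> cball x (r x) \<noteq> {}} \<le> 14 * \<zeta>" if x: "x \<in> S" for x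
  proof (rule directional_count[OF lim \<eta>])
    show "0 < r x" using r SU x by blast
    fix b assume "b \<in> {y\<in>S. (y, x) \<in> R \<and> cball y (r y) \<inter> cball x (r x) \<noteq> {}}"
    then obtain z where b: "b \<in> S" "(b, x) \<in> R" and z: "dist b z \<le> r b" "dist x z \<le> r x" by auto
    have "r b < dist b x" using S[of x] x b by blast
    moreover have "dist x b \<le> r x + r b" using z dist_triangle2[of x b z] by simp
    moreover have "r x \<le> 7/6 * r b" using rR b x SU by blast
    moreover have "r x < \<xi> / 2" "r b < \<xi> / 2" "0 < r b" using r SU x b by auto
    ultimately show "0 < r b \<and> r b < dist x b \<and> dist x b \<le> r x + r b \<and> r x \<le> 7/6 * r b \<and> r x + r b < \<xi>"
      by (simp add: dist_commute)
  qed (use sep in auto)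
  from wf_greedy_colouring[OF wfR, of S "\<lambda>y x. cball y (r y) \<inter> cball x (r x) \<noteq> {}", OF this]
  obtain c :: "'a \<Rightarrow> nat" where c: "\<And>x. x \<in> S \<Longrightarrow> c x \<le> 14 * \<zeta>"
    "\<And>x y. x \<in> S \<Longrightarrow> y \<in> S \<Longrightarrow> (y, x) \<in> R \<Longrightarrow> cball y (r y) \<inter> cball x (r x) \<noteq> {} \<Longrightarrow> c x \<noteq> c y"
    by blast
  show thesis
  proof (rule that[OF SU cS cov c(1)])
    fix x y assume "x \<in> S" "y \<in> S" "x \<noteq> y" "c x = c y"
    then show "cball x (r x) \<inter> cball y (r y) = {}" using tot[of x y] c(2)[of x y] c(2)[of y x] by auto
  qed
qed

section \<open>Outer regularity of locally finite measures\<close>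

text \<open>Approximation from inside by closed and from outside by open sets is symmetric under
  complements, so it passes from the closed generators through the whole Borel
  sigma-algebra.\<close>

lemma finite_measure_approx_closed_open:
  fixes M :: "'a::metric_space measure"
  assumes "finite_measure M" and sets: "sets M = sets borel" and "A \<in> sets borel" and "e > 0"
  obtains F V where "closed F" "open V" "F \<subseteq> A" "A \<subseteq> V" "measure M (V - F) < e"
proof -
  interpret finite_measure M by fact
  have op: "V \<in> sets M" if "open V" for V using that sets by simp
  have cl: "V \<in> sets M" if "closed V" for V using that sets by simp
  have "A \<in> sigma_sets UNIV (Collect closed)"
    using assms(3) by (simp add: borel_eq_closed)
  then have "\<forall>e>0. \<exists>F V. closed F \<and> open V \<and> F \<subseteq> A \<and> A \<subseteq> V \<and> measure M (V - F) < e"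
  proof (induction rule: sigma_sets.induct)
    case (Basic A)
    then have A: "closed A" by simp
    show ?case
    proof (intro allI impI)
      fix e :: real assume e: "e > 0"
      show "\<exists>F V. closed F \<and> open V \<and> F \<subseteq> A \<and> A \<subseteq> V \<and> measure M (V - F) < e"
      \<comment> \<open>The function \<open>infdist\<close> is 0 for the empty set, whose
        neighbourhoods \<open>V n\<close> would therefore be the whole space.\<close>
      proof (cases "A = {}")
        case True
        then show ?thesis using e by (intro exI[of _ "{}"]) simp
      next
        case False
        define V where "V n = {x. infdist x A < 1 / real (Suc n)}" for n
        have V: "open (V n)" "A \<subseteq> V n" for n
          unfolding V_def by (auto intro!: open_Collect_less continuous_intros)
        have "decseq (\<lambda>n. V n - A)"
          unfolding decseq_def V_def
          by (auto intro: less_le_trans simp: frac_le)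
        moreover have emp: "(\<Inter>n. V n - A) = {}"
        proof -
          have False if "x \<notin> A" "\<And>n. x \<in> V n" for x
          proof -
            have "infdist x A > 0"
              using in_closed_iff_infdist_zero[OF A False, of x] that(1) infdist_nonneg[of x A]
              by linarith
            then obtain n where "1 / real (Suc n) < infdist x A" using nat_approx_posE by blast
            then show False using that(2)[of n] by (simp add: V_def)
          qed
          then show ?thesis by blast
        qed
        moreover have "range (\<lambda>n. V n - A) \<subseteq> sets M" using V(1) A op cl by auto
        ultimately have "(\<lambda>n. measure M (V n - A)) \<longlonglongrightarrow> 0"
          using finite_Lim_measure_decseq[of "\<lambda>n. V n - A"] by (metis emp measure_empty)
        from eventually_happens'[OF sequentially_bot order_tendstoD(2)[OF this e]]
        obtain n where "measure M (V n - A) < e" by blast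
        then show ?thesis using V A by blast
      qed
    qed
  next
    case Empty
    show ?case by (intro allI impI exI[of _ "{}"]) simp
  next
    case (Compl A)
    show ?case
    proof (intro allI impI)
      fix e :: real assume e: "e > 0"
      from Compl.IH[rule_format, OF e]
      obtain F V where "closed F" "open V" "F \<subseteq> A" "A \<subseteq> V" "measure M (V - F) < e"
        by (elim exE conjE)
      moreover have "- F - - V = V - F" by (simp add: Diff_eq Int_commute)
      ultimately show "\<exists>F V. closed F \<and> open V \<and> F \<subseteq> UNIV - A \<and> UNIV - A \<subseteq> V \<and> measure M (V - F) < e"
        by (intro exI[of _ "- V"] exI[of _ "- F"]) auto
    qed
  next
    case (Union A)
    show ?case
    proof (intro allI impI)
      fix e :: real assume e: "e > 0"
      have "\<forall>i. \<exists>F V. closed F \<and> open V \<and> F \<subseteq> A i \<and> A i \<subseteq> V \<and> measure M (V - F) < (e / 2) * (1/2) ^ Suc i"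
        by (intro allI Union.IH[rule_format]) (use e in simp)
      then obtain F V where FV: "\<And>i. closed (F i)" "\<And>i. open (V i)" "\<And>i. F i \<subseteq> A i" "\<And>i. A i \<subseteq> V i"
        "\<And>i. measure M (V i - F i) < (e / 2) * (1/2) ^ Suc i" by metis
      \<comment> \<open>The errors of all the pieces add up to \<open>e / 2\<close>; the other half
        pays for truncating the union of the closed sets.\<close>
      have geo: "(\<lambda>i. (e / 2) * (1/2) ^ Suc i) sums (e / 2)"
        using sums_mult[OF power_half_series, of "e / 2"] by simp
      have sm: "summable (\<lambda>i. measure M (V i - F i))"
        by (rule summable_comparison_test'[OF sums_summable[OF geo], of 0])
          (use FV(5) in \<open>simp add: less_imp_le del: power_Suc\<close>)
      have s: "V i - F i \<in> sets M" for i using FV op cl by blast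
      have "measure M (\<Union>i. V i - F i) \<le> (\<Sum>i. measure M (V i - F i))"
        by (rule finite_measure_subadditive_countably) (use s sm in auto)
      also have "\<dots> \<le> e / 2"
        using suminf_le[OF less_imp_le[OF FV(5)] sm sums_summable[OF geo]] sums_unique[OF geo] by simp
      finally have 1: "measure M (\<Union>i. V i - F i) \<le> e / 2" .
      \<comment> \<open>The infinite union of the \<open>F i\<close> need not be closed. Finite
        unions are, and continuity from above makes the loss small.\<close>
      define W where "W n = (\<Union>i. V i) - (\<Union>i\<le>n. F i)" for n
      have oV: "open (\<Union>i. V i)" and cF: "closed (\<Union>i\<le>n. F i)" for n using FV by auto
      have "range W \<subseteq> sets M" unfolding W_def using op[OF oV] cl[OF cF] by auto
      moreover have "decseq W" unfolding decseq_def W_def by fastforce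
      ultimately have "(\<lambda>n. measure M (W n)) \<longlonglongrightarrow> measure M (\<Inter>n. W n)"
        by (rule finite_Lim_measure_decseq)
      moreover have "measure M (\<Inter>n. W n) < e"
      proof -
        have "(\<Inter>n. W n) \<subseteq> (\<Union>i. V i - F i)" unfolding W_def by auto
        then have "measure M (\<Inter>n. W n) \<le> measure M (\<Union>i. V i - F i)"
          using s by (intro finite_measure_mono) auto
        then show ?thesis using 1 e by linarith
      qed
      ultimately have "\<forall>\<^sub>F n in sequentially. measure M (W n) < e" by (rule order_tendstoD(2))
      from eventually_happens'[OF sequentially_bot this]
      obtain n where "measure M (W n) < e" by blast
      then show "\<exists>F V. closed F \<and> open V \<and> F \<subseteq> (\<Union>i. A i) \<and> (\<Union>i. A i) \<subseteq> V \<and> measure M (V - F) < e"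
      proof (intro exI conjI)
        show "(\<Union>i\<le>n. F i) \<subseteq> (\<Union>i. A i)" "(\<Union>i. A i) \<subseteq> (\<Union>i. V i)" using FV(3,4) by fast+
      qed (use oV cF[of n] in \<open>simp_all add: W_def\<close>)
    qed
  qed
  from this[rule_format, OF \<open>e > 0\<close>] show thesis using that by (elim exE conjE)
qed

text \<open>The finite case applies to \<mu> restricted to each \<open>G i\<close>. It controls the
  excess of \<open>V i\<close> over \<open>A\<close> only inside \<open>G i\<close>, hence the
  approximating set is the union of the \<open>G i \<inter> V i\<close>.\<close>

lemma sigma_finite_open_outer_approx:
  fixes \<mu> :: "'a::metric_space measure"
  assumes sets: "sets \<mu> = sets borel"
    and G: "\<And>i::nat. open (G i)" "\<And>i. emeasure \<mu> (G i) < \<infinity>" "(\<Union>i. G i) = UNIV"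
    and A: "A \<in> sets borel" and e: "e > 0"
  obtains V where "open V" "A \<subseteq> V" "emeasure \<mu> V \<le> emeasure \<mu> A + ennreal e"
proof -
  define M where "M i = density \<mu> (indicator (G i))" for i
  have Gs: "G i \<in> sets \<mu>" for i using G sets by simp
  have sM: "sets (M i) = sets borel" for i by (simp add: M_def sets)
  have eM: "emeasure (M i) X = emeasure \<mu> (G i \<inter> X)" if "X \<in> sets borel" for i X
    unfolding M_def using emeasure_restricted[OF Gs, of X i] that sets by simp
  have fM: "finite_measure (M i)" for i
  proof (rule finite_measureI)
    have "emeasure (M i) (space (M i)) = emeasure \<mu> (G i)"
      using eM[of UNIV i] sets_eq_imp_space_eq[OF sM[of i]] by simp
    then show "emeasure (M i) (space (M i)) \<noteq> \<infinity>" using G(2)[of i] by simp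
  qed
  have "\<forall>i. \<exists>V. open V \<and> A \<subseteq> V \<and> emeasure \<mu> (G i \<inter> (V - A)) \<le> ennreal (e * (1/2) ^ Suc i)"
  proof
    fix i
    interpret finite_measure "M i" by (rule fM)
    have "e * (1/2) ^ Suc i > 0" using e by simp
    from finite_measure_approx_closed_open[OF fM sM A this, of i]
    obtain F V where FV: "closed F" "open V" "F \<subseteq> A" "A \<subseteq> V" "measure (M i) (V - F) < e * (1/2) ^ Suc i"
      by blast
    have "emeasure \<mu> (G i \<inter> (V - A)) \<le> emeasure \<mu> (G i \<inter> (V - F))"
      using FV Gs sets by (intro emeasure_mono) (auto intro!: sets.Int sets.Diff)
    also have "\<dots> = ennreal (measure (M i) (V - F))"
      using FV by (subst eM[symmetric]) (auto simp: emeasure_eq_measure)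
    also have "\<dots> \<le> ennreal (e * (1/2) ^ Suc i)" using FV(5) by (intro ennreal_leI) simp
    finally show "\<exists>V. open V \<and> A \<subseteq> V \<and> emeasure \<mu> (G i \<inter> (V - A)) \<le> ennreal (e * (1/2) ^ Suc i)"
      using FV by blast
  qed
  then obtain V where V: "\<And>i. open (V i)" "\<And>i. A \<subseteq> V i"
    "\<And>i. emeasure \<mu> (G i \<inter> (V i - A)) \<le> ennreal (e * (1/2) ^ Suc i)" by metis
  have Ds: "G i \<inter> (V i - A) \<in> sets \<mu>" for i using V Gs sets A by auto
  have "emeasure \<mu> (\<Union>i. G i \<inter> V i) \<le> emeasure \<mu> (A \<union> (\<Union>i. G i \<inter> (V i - A)))"
    using Ds A sets by (intro emeasure_mono) auto
  also have "\<dots> \<le> emeasure \<mu> A + emeasure \<mu> (\<Union>i. G i \<inter> (V i - A))"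
    using Ds A sets by (intro emeasure_subadditive) auto
  also have "emeasure \<mu> (\<Union>i. G i \<inter> (V i - A)) \<le> (\<Sum>i. emeasure \<mu> (G i \<inter> (V i - A)))"
    using Ds by (intro emeasure_subadditive_countably) auto
  also have "\<dots> \<le> (\<Sum>i. ennreal (e * (1/2) ^ Suc i))" by (intro suminf_le V(3)) auto
  also have "\<dots> = ennreal e"
    using sums_mult[OF power_half_series, of e] e by (intro suminf_ennreal_eq) auto
  finally have "emeasure \<mu> (\<Union>i. G i \<inter> V i) \<le> emeasure \<mu> A + ennreal e"
    by (simp add: add_left_mono)
  moreover have "A \<subseteq> (\<Union>i. G i \<inter> V i)" 
  proof
    fix x assume "x \<in> A"
    moreover have "x \<in> (\<Union>i. G i)" by (simp add: G(3))
    ultimately show "x \<in> (\<Union>i. G i \<inter> V i)" using V(2) by auto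
  qed
  moreover have "open (\<Union>i. G i \<inter> V i)" using V(1) G(1) by auto
  ultimately show thesis using that by blast
qed

text \<open>Among the balls with centre in \<open>D\<close> and radius \<open>1 / (n + 1)\<close>,
  those of finite measure still cover. Boundedness of the pieces later makes each \<nu> finite on
  them.\<close>

lemma locally_finite_open_cover:
  fixes \<mu> :: "'a::metric_space measure"
  assumes sets: "sets \<mu> = sets borel" and lf: "locally_finite_measure \<mu>"
    and D: "countable D" "closure D = (UNIV :: 'a set)"
  obtains G :: "nat \<Rightarrow> 'a set" where "\<And>i. open (G i)" "\<And>i. bounded (G i)"
    "\<And>i. emeasure \<mu> (G i) < \<infinity>" "(\<Union>i. G i) = UNIV"
proof -
  define \<G> where "\<G> = {B \<in> (\<lambda>(d, n). ball d (1 / real (Suc n))) ` (D \<times> UNIV). emeasure \<mu> B < \<infinity>}"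
  have c: "countable \<G>" unfolding \<G>_def using D(1) by (intro countable_Collect) auto
  have cov: "\<Union>\<G> = UNIV"
  proof -
    have "\<exists>B\<in>\<G>. x \<in> B" for x
    proof -
      obtain U where U: "open U" "x \<in> U" "emeasure \<mu> U < \<infinity>"
        using lf unfolding locally_finite_measure_def by blast
      then obtain e where e: "e > 0" "ball x e \<subseteq> U" using open_contains_ball by blast
      obtain n where n: "1 / real (Suc n) < e / 2" using nat_approx_posE e(1) half_gt_zero by blast
      have "1 / real (Suc n) > 0" by simp
      then obtain d where d: "d \<in> D" "dist x d < 1 / real (Suc n)" using dense_dist[OF D(2)] by blast
      have "ball d (1 / real (Suc n)) \<subseteq> U"
      proof
        fix y assume "y \<in> ball d (1 / real (Suc n))"
        then have "dist x y < e" using d n dist_triangle[of x y d] by simp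
        then show "y \<in> U" using e by auto
      qed
      then have "emeasure \<mu> (ball d (1 / real (Suc n))) \<le> emeasure \<mu> U"
        using U sets by (intro emeasure_mono) auto
      then have "ball d (1 / real (Suc n)) \<in> \<G>" using U d(1) unfolding \<G>_def by force
      then show ?thesis using d(2) by (intro bexI[of _ "ball d (1 / real (Suc n))"]) (simp_all add: dist_commute)
    qed
    then show ?thesis by blast
  qed
  then have ne: "\<G> \<noteq> {}" by blast
  have "from_nat_into \<G> i \<in> \<G>" for i by (rule from_nat_into[OF ne])
  moreover have "(\<Union>i. from_nat_into \<G> i) = UNIV" using cov range_from_nat_into[OF ne c] by simp
  moreover have "open B \<and> bounded B \<and> emeasure \<mu> B < \<infinity>" if "B \<in> \<G>" for B
    using that by (auto simp: \<G>_def)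
  ultimately show thesis
    by (intro that[of "from_nat_into \<G>"]) blast+
qed

section \<open>A Vitali covering theorem\<close>

lemma finite_subfamily_emeasure:
  assumes S: "countable S" and B: "\<And>x. x \<in> S \<Longrightarrow> B x \<in> sets M"
    and a: "a < emeasure M (\<Union>x\<in>S. B x)"
  obtains T where "finite T" "T \<subseteq> S" "a < emeasure M (\<Union>x\<in>T. B x)"
proof -
  have ne: "S \<noteq> {}" using a by auto
  define W where "W n = (\<Union>i\<le>n::nat. B (from_nat_into S i))" for n
  have "range W \<subseteq> sets M" using B from_nat_into[OF ne] by (auto simp: W_def)
  moreover have "incseq W" unfolding incseq_def W_def by fastforce
  ultimately have "(SUP n. emeasure M (W n)) = emeasure M (\<Union>n. W n)"
    by (rule SUP_emeasure_incseq)
  also have "(\<Union>n. W n) = (\<Union>x\<in>S. B x)"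
    unfolding W_def by (subst (2) range_from_nat_into[OF ne S, symmetric]) auto
  finally obtain n where "a < emeasure M (W n)" using a by (metis less_SUP_iff)
  then show thesis
    using from_nat_into[OF ne] by (intro that[of "from_nat_into S ` {..n}"]) (auto simp: W_def)
qed

text \<open>Balls are indexed by centre and radius because the selection predicate \<open>P\<close>
  of the covering theorems depends on both, and these are not determined by the ball as a
  set.\<close>

definition disjoint_balls :: "('a::metric_space \<times> real) set \<Rightarrow> bool" where
  "disjoint_balls T \<longleftrightarrow> disjoint_family_on (\<lambda>(x, r). cball x r) T"

text \<open>Some colour class of the Besicovitch cover carries at least the average share of the
  measure; continuity from below then reduces this class to finitely many balls.\<close>

lemma besicovitch_finite_disjoint:
  fixes U :: "'a::metric_space set"
  assumes lim: "directionally_limited_at \<xi> \<eta> \<zeta> (UNIV :: 'a set)" and \<eta>: "\<eta> \<le> 1/3" and \<xi>: "\<xi> > 0"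
    and D: "countable D" "closure D = (UNIV :: 'a set)"
    and sets: "sets \<mu> = sets borel" and U: "open U" "emeasure \<mu> U < \<infinity>"
    and fine: "\<forall>x\<in>U. \<forall>\<rho>>0. \<exists>r. 0 < r \<and> r < \<rho> \<and> P x r"
  shows "\<exists>T. finite T \<and> disjoint_balls T \<and> (\<forall>(x, r)\<in>T. 0 < r \<and> P x r \<and> cball x r \<subseteq> U) \<and>
    measure \<mu> U \<le> real (28 * \<zeta> + 2) * measure \<mu> (\<Union>(x, r)\<in>T. cball x r)"
proof (cases "measure \<mu> U = 0")
  case True
  then show ?thesis by (intro exI[of _ "{}"]) (simp add: disjoint_balls_def disjoint_family_on_def)
next
  case False
  then have mpos: "measure \<mu> U > 0" using measure_nonneg[of \<mu> U] by linarith
  have "\<exists>r. 0 < r \<and> r < \<xi> / 2 \<and> P x r \<and> cball x r \<subseteq> U" if x: "x \<in> U" for x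
  proof -
    obtain e where e: "e > 0" "cball x e \<subseteq> U" using U(1) x open_contains_cball by blast
    then obtain r where "0 < r" "r < min e (\<xi> / 2)" "P x r" using fine[rule_format, OF x, of "min e (\<xi> / 2)"] \<xi> by auto
    moreover from this have "cball x r \<subseteq> cball x e" by (intro subset_cball) simp
    ultimately show ?thesis using e by auto
  qed
  then obtain r where r: "\<And>x. x \<in> U \<Longrightarrow> 0 < r x \<and> r x < \<xi> / 2 \<and> P x (r x) \<and> cball x (r x) \<subseteq> U" by metis
  then have r': "\<And>x. x \<in> U \<Longrightarrow> 0 < r x \<and> r x < \<xi> / 2" by blast
  obtain S c where S: "S \<subseteq> U" "countable S" "U \<subseteq> (\<Union>x\<in>S. cball x (r x))"
    "\<And>x. x \<in> S \<Longrightarrow> c x \<le> 14 * \<zeta>"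
    "\<And>x y. x \<in> S \<Longrightarrow> y \<in> S \<Longrightarrow> x \<noteq> y \<Longrightarrow> c x = (c y::nat) \<Longrightarrow> cball x (r x) \<inter> cball y (r y) = {}"
    by (rule besicovitch_covering[OF lim \<eta> D r']) blast+
  define B where "B x = cball x (r x)" for x
  define S' where "S' i = {x\<in>S. c x = i}" for i
  define V where "V i = (\<Union>x\<in>S' i. B x)" for i
  have Bs: "B x \<in> sets \<mu>" for x using sets by (simp add: B_def)
  have S'c: "countable (S' i)" for i unfolding S'_def using S(2) by simp
  have Vs: "V i \<in> sets \<mu>" for i unfolding V_def using S'c Bs by blast
  have Us: "U \<in> sets \<mu>" using U sets by simp
  have VU: "V i \<subseteq> U" for i unfolding V_def S'_def B_def using S(1) r by blast
  have fin: "emeasure \<mu> W = ennreal (measure \<mu> W)" if "W \<subseteq> U" for W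
    using emeasure_mono[OF that Us] U(2) by (intro emeasure_eq_ennreal_measure) (auto simp: top_unique)
  have UV: "U = (\<Union>i\<le>14 * \<zeta>. V i)"
  proof
    show "U \<subseteq> (\<Union>i\<le>14 * \<zeta>. V i)" using S(3,4) unfolding V_def S'_def B_def by blast
  qed (use VU in blast)
  \<comment> \<open>There are \<open>14 * \<zeta> + 1\<close> colours. Doubling this number makes
    the inequality strict for \<open>measure \<mu> U > 0\<close>, as the passage to a finite
    subfamily requires.\<close>
  obtain i where i: "measure \<mu> (V i) > measure \<mu> U / real (28 * \<zeta> + 2)"
  proof (rule ccontr)
    assume "\<not> thesis"
    then have le: "measure \<mu> (V i) \<le> measure \<mu> U / real (28 * \<zeta> + 2)" for i
      using that by (meson not_le)
    have "measure \<mu> U \<le> (\<Sum>i\<le>14 * \<zeta>. measure \<mu> (V i))"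
      by (subst UV, intro measure_subadditive_finite) (use Vs fin[OF VU] in auto)
    also have "\<dots> \<le> (\<Sum>i\<le>14 * \<zeta>. measure \<mu> U / real (28 * \<zeta> + 2))" by (intro sum_mono le)
    also have "\<dots> = measure \<mu> U / 2" by (simp add: field_simps)
    finally show False using mpos by simp
  qed
  then have "ennreal (measure \<mu> U / real (28 * \<zeta> + 2)) < emeasure \<mu> (\<Union>x\<in>S' i. B x)"
    using fin[OF VU[of i]] by (simp add: V_def ennreal_less_iff)
  from finite_subfamily_emeasure[OF S'c Bs this]
  obtain T where T: "finite T" "T \<subseteq> S' i"
    "ennreal (measure \<mu> U / real (28 * \<zeta> + 2)) < emeasure \<mu> (\<Union>x\<in>T. B x)" .
  have "(\<Union>x\<in>T. B x) \<subseteq> U" using T(2) VU[of i] unfolding V_def by blast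
  then have "measure \<mu> U / real (28 * \<zeta> + 2) < measure \<mu> (\<Union>x\<in>T. B x)"
    using T(3) fin[of "\<Union>x\<in>T. B x"] by (simp add: ennreal_less_iff)
  then have m: "measure \<mu> U \<le> real (28 * \<zeta> + 2) * measure \<mu> (\<Union>x\<in>T. B x)"
    by (simp add: field_simps del: of_nat_add of_nat_mult)
  show ?thesis
  proof (intro exI[of _ "(\<lambda>x. (x, r x)) ` T"] conjI)
    show "disjoint_balls ((\<lambda>x. (x, r x)) ` T)"
      unfolding disjoint_balls_def disjoint_family_on_def
    proof (intro ballI impI)
      fix m n assume "m \<in> (\<lambda>x. (x, r x)) ` T" "n \<in> (\<lambda>x. (x, r x)) ` T" "m \<noteq> n"
      then obtain x y where "m = (x, r x)" "n = (y, r y)" "x \<in> T" "y \<in> T" "x \<noteq> y" by blast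
      moreover from this have "x \<in> S" "y \<in> S" "c x = c y" using T(2) by (auto simp: S'_def)
      ultimately show "(case m of (x, r) \<Rightarrow> cball x r) \<inter> (case n of (x, r) \<Rightarrow> cball x r) = {}"
        using S(5)[of x y] by simp
    qed
    show "\<forall>(x, s)\<in>(\<lambda>x. (x, r x)) ` T. 0 < s \<and> P x s \<and> cball x s \<subseteq> U"
    proof clarify
      fix x assume "x \<in> T"
      then have "x \<in> U" using T(2) S(1) unfolding S'_def by blast
      then show "0 < r x \<and> P x (r x) \<and> cball x (r x) \<subseteq> U" using r[of x] by simp
    qed
    show "measure \<mu> U \<le> real (28 * \<zeta> + 2) * measure \<mu> (\<Union>(x, r)\<in>(\<lambda>x. (x, r x)) ` T. cball x r)"
      using m by (simp add: B_def)
  qed (use T(1) in simp)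
qed

text \<open>A finite union of closed balls is closed, so what it leaves of \<open>U\<close> is open
  and the previous lemma applies again. Each round multiplies the uncovered measure by at most the
  fixed factor \<theta> < 1.\<close>

lemma vitali_covering:
  fixes U :: "'a::metric_space set"
  assumes lim: "directionally_limited_at \<xi> \<eta> \<zeta> (UNIV :: 'a set)" and \<eta>: "\<eta> \<le> 1/3" and \<xi>: "\<xi> > 0"
    and D: "countable D" "closure D = (UNIV :: 'a set)"
    and sets: "sets \<mu> = sets borel" and U: "open U" "emeasure \<mu> U < \<infinity>"
    and fine: "\<forall>x\<in>U. \<forall>\<rho>>0. \<exists>r. 0 < r \<and> r < \<rho> \<and> P x r"
    and \<epsilon>: "\<epsilon> > 0"
  shows "\<exists>T. finite T \<and> disjoint_balls T \<and> (\<forall>(x, r)\<in>T. 0 < r \<and> P x r \<and> cball x r \<subseteq> U) \<and>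
    emeasure \<mu> U \<le> emeasure \<mu> (\<Union>(x, r)\<in>T. cball x r) + ennreal \<epsilon>"
proof -
  define \<theta> where "\<theta> = 1 - 1 / real (28 * \<zeta> + 2)"
  have \<theta>: "0 \<le> \<theta>" "\<theta> < 1" by (auto simp: \<theta>_def)
  have Us: "U \<in> sets \<mu>" using U sets by simp
  have fin: "emeasure \<mu> W = ennreal (measure \<mu> W)" if "W \<subseteq> U" for W
    using emeasure_mono[OF that Us] U(2) by (intro emeasure_eq_ennreal_measure) (auto simp: top_unique)
  define K where "K T = (\<Union>(x, r)\<in>T. cball x r)" for T :: "('a \<times> real) set"
  have K: "closed (K T)" if "finite T" for T unfolding K_def using that by (intro closed_UN) auto
  have ex: "\<exists>T. finite T \<and> disjoint_balls T \<and> (\<forall>(x, r)\<in>T. 0 < r \<and> P x r \<and> cball x r \<subseteq> U) \<and>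
        measure \<mu> (U - K T) \<le> \<theta> ^ k * measure \<mu> U" for k
  proof (induction k)
    case 0
    show ?case
      by (intro exI[of _ "{}"]) (simp add: K_def disjoint_balls_def disjoint_family_on_def)
  next
    case (Suc k)
    then obtain T where T: "finite T" "disjoint_balls T" "\<forall>(x, r)\<in>T. 0 < r \<and> P x r \<and> cball x r \<subseteq> U"
      "measure \<mu> (U - K T) \<le> \<theta> ^ k * measure \<mu> U" by blast
    define U' where "U' = U - K T"
    have U': "open U'" "U' \<subseteq> U" "emeasure \<mu> U' < \<infinity>" unfolding U'_def using U(1) K[OF T(1)] fin[of "U - K T"]
      by (auto simp: open_Diff)
    have "\<forall>x\<in>U'. \<forall>\<rho>>0. \<exists>r. 0 < r \<and> r < \<rho> \<and> P x r"
      using fine U'(2) by (meson subsetD)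
    from besicovitch_finite_disjoint[OF lim \<eta> \<xi> D sets U'(1,3) this]
    obtain T' where T': "finite T'" "disjoint_balls T'"
      "\<forall>(x, r)\<in>T'. 0 < r \<and> P x r \<and> cball x r \<subseteq> U'"
      "measure \<mu> U' \<le> real (28 * \<zeta> + 2) * measure \<mu> (K T')"
      unfolding K_def by (elim exE conjE)
    have KT': "K T' \<subseteq> U'" unfolding K_def using T'(3) by fastforce
    have "K T' \<in> sets \<mu>" "U' \<in> sets \<mu>" using K[OF T'(1)] U'(1) sets by auto
    then have "measure \<mu> (U' - K T') = measure \<mu> U' - measure \<mu> (K T')"
      using U'(3) KT' by (intro measure_Diff) auto
    also have "\<dots> \<le> \<theta> * measure \<mu> U'"
    proof -
      have "measure \<mu> U' / real (28 * \<zeta> + 2) \<le> measure \<mu> (K T')"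
        using T'(4) by (simp add: field_simps del: of_nat_add of_nat_mult)
      then show ?thesis by (simp add: \<theta>_def left_diff_distrib)
    qed
    also have "\<dots> \<le> \<theta> * (\<theta> ^ k * measure \<mu> U)" using T(4) \<theta> unfolding U'_def by (intro mult_left_mono)
    also have "U' - K T' = U - K (T \<union> T')" unfolding U'_def K_def by auto
    finally have "measure \<mu> (U - K (T \<union> T')) \<le> \<theta> ^ Suc k * measure \<mu> U" by (simp add: mult.assoc)
    \<comment> \<open>The new balls lie in \<open>U'\<close>, which excludes all old ones.\<close>
    moreover have "disjoint_balls (T \<union> T')"
    proof -
      have *: "cball x r \<inter> cball y s = {}" if "(x, r) \<in> T" "(y, s) \<in> T'" for x r y s
        using T'(3) that unfolding U'_def K_def by blast
      have cross: "(case m of (x, r) \<Rightarrow> cball x r) \<inter> (case n of (x, r) \<Rightarrow> cball x r) = {}"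
        if "m \<in> T" "n \<in> T'" for m n
        using *[of "fst m" "snd m" "fst n" "snd n"] that by (simp add: case_prod_unfold)
      show ?thesis
        unfolding disjoint_balls_def disjoint_family_on_def
      proof (intro ballI impI)
        fix m n assume mn: "m \<in> T \<union> T'" "n \<in> T \<union> T'" "m \<noteq> n"
        note d = disjoint_family_onD[OF T(2)[unfolded disjoint_balls_def] _ _ mn(3)]
          disjoint_family_onD[OF T'(2)[unfolded disjoint_balls_def] _ _ mn(3)]
        from mn(1,2) show "(case m of (x, r) \<Rightarrow> cball x r) \<inter> (case n of (x, r) \<Rightarrow> cball x r) = {}"
          by (elim UnE) (use d cross[of m n] cross[of n m] in \<open>simp_all add: Int_commute\<close>)
      qed
    qed
    moreover have "\<forall>(x, r)\<in>T'. 0 < r \<and> P x r \<and> cball x r \<subseteq> U"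
    proof clarify
      fix x r assume "(x, r) \<in> T'"
      then have "0 < r \<and> P x r \<and> cball x r \<subseteq> U'" using T'(3) by blast
      then show "0 < r \<and> P x r \<and> cball x r \<subseteq> U" using U'(2) by (meson order_trans)
    qed
    then have "\<forall>(x, r)\<in>T \<union> T'. 0 < r \<and> P x r \<and> cball x r \<subseteq> U"
      using T(3) unfolding ball_Un by (intro conjI)
    ultimately show ?case using T(1) T'(1) by (intro exI[of _ "T \<union> T'"] conjI finite_UnI)
  qed
  have "(\<lambda>k. \<theta> ^ k * measure \<mu> U) \<longlonglongrightarrow> 0"
    using tendsto_mult_right[OF LIMSEQ_power_zero[of \<theta>], of "measure \<mu> U"] \<theta> by simp
  then obtain k where k: "\<theta> ^ k * measure \<mu> U < \<epsilon>"
    using eventually_happens'[OF sequentially_bot order_tendstoD(2)[OF _ \<epsilon>]] by blast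
  obtain T where T: "finite T" "disjoint_balls T" "\<forall>(x, r)\<in>T. 0 < r \<and> P x r \<and> cball x r \<subseteq> U"
      "measure \<mu> (U - K T) \<le> \<theta> ^ k * measure \<mu> U" using ex[of k] by blast
  have "emeasure \<mu> (U - K T) \<le> ennreal \<epsilon>" using fin[of "U - K T"] T(4) k by (simp add: ennreal_leI)
  moreover have "emeasure \<mu> U \<le> emeasure \<mu> (K T \<union> (U - K T))"
    using Us K[OF T(1)] sets by (intro emeasure_mono) auto
  moreover have "\<dots> \<le> emeasure \<mu> (K T) + emeasure \<mu> (U - K T)"
    using Us K[OF T(1)] sets by (intro emeasure_subadditive) auto
  ultimately have "emeasure \<mu> U \<le> emeasure \<mu> (K T) + ennreal \<epsilon>"
    by (meson add_left_mono order_trans)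
  then show ?thesis using T(1-3) unfolding K_def by (intro exI[of _ T] conjI)
qed

section \<open>Comparison with the packing construction\<close>

text \<open>If \<open>m k > \<epsilon> * v k\<close> for all \<open>k\<close>, then chaining both
  recursions gives \<open>\<epsilon> * v 0 \<le> (h / g) ^ k * m 0\<close>, whose right side tends
  to 0.\<close>

lemma geometric_domination:
  fixes m v :: "nat \<Rightarrow> real"
  assumes "\<And>k. g * m (Suc k) \<le> m k" "\<And>k. v k \<le> h * v (Suc k)"
    and "0 < h" "h < g" "0 < v 0" "\<epsilon> > 0"
  shows "\<exists>k. m k \<le> \<epsilon> * v k"
proof (rule ccontr)
  assume "\<not> ?thesis"
  then have lt: "\<epsilon> * v k < m k" for k by (simp add: not_le)
  have g: "g > 0" using assms by linarith
  have mk: "g ^ k * m k \<le> m 0" for k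
  proof (induction k)
    case (Suc k)
    have "g ^ k * (g * m (Suc k)) \<le> g ^ k * m k" using assms(1) g by (intro mult_left_mono) auto
    then show ?case using Suc by (simp add: mult_ac)
  qed simp
  have vk: "v 0 \<le> h ^ k * v k" for k
  proof (induction k)
    case (Suc k)
    have "h ^ k * v k \<le> h ^ k * (h * v (Suc k))" using assms(2,3) by (intro mult_left_mono) auto
    then show ?case using Suc by (simp add: mult_ac)
  qed simp
  have "\<epsilon> * v 0 \<le> (h / g) ^ k * m 0" for k
  proof -
    have "\<epsilon> * v 0 \<le> \<epsilon> * (h ^ k * v k)" using vk[of k] assms(6) by (intro mult_left_mono) auto
    also have "\<dots> = h ^ k * (\<epsilon> * v k)" by simp
    also have "\<dots> \<le> h ^ k * m k" using lt[of k] assms(3) by (intro mult_left_mono) auto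
    also have "\<dots> = (h / g) ^ k * (g ^ k * m k)" using g by (simp add: power_divide)
    also have "\<dots> \<le> (h / g) ^ k * m 0" using mk[of k] assms(3) g by (intro mult_left_mono) auto
    finally show ?thesis .
  qed
  moreover have "(\<lambda>k. (h / g) ^ k * m 0) \<longlonglongrightarrow> 0 * m 0"
    using assms(3,4) g by (intro tendsto_mult_right LIMSEQ_power_zero) auto
  ultimately have "\<epsilon> * v 0 \<le> 0 * m 0" by (intro LIMSEQ_le_const) auto
  moreover have "\<epsilon> * v 0 > 0" using assms(5,6) by simp
  ultimately show False by simp
qed

text \<open>This supplies arbitrarily small good radii at \<open>x\<close>.
  \<open>geometric_domination\<close> is applied with \<open>m\<close> and \<open>v\<close> the
  \<mu>- and \<nu>-measures of the balls of radii \<open>s k\<close>: failure of the first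
  alternative gives the recursion for \<open>m\<close>, and its conclusion contradicts failure of
  the second.\<close>

lemma asymptotically_bounded_fine:
  fixes \<mu> \<nu> :: "'a::metric_space measure"
  assumes \<nu>: "asymptotically_bounded_measure \<alpha> \<gamma> \<nu>" and \<alpha>: "0 < \<alpha>" "\<alpha> \<le> 1" and \<gamma>: "\<gamma> \<ge> 1"
    and sets: "sets \<mu> = sets borel" and R: "R > 0" "emeasure \<mu> (cball x R) < \<infinity>"
    and \<epsilon>: "\<epsilon> > 0" and \<rho>: "\<rho> > 0"
  shows "\<exists>r. 0 < r \<and> r < \<rho> \<and>
    (emeasure \<mu> (cball x r) \<le> ennreal (\<gamma> + \<epsilon>) * emeasure \<mu> (cball x (\<alpha> * r)) \<or>
     emeasure \<mu> (cball x r) \<le> ennreal \<epsilon> * emeasure \<nu> (cball x r))"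
proof (rule ccontr)
  assume neg: "\<not> ?thesis"
  have "Limsup (at_right 0) (\<lambda>r. emeasure \<nu> (cball x r) / emeasure \<nu> (cball x (\<alpha> * r))) \<le> ennreal \<gamma>"
    using \<nu> unfolding asymptotically_bounded_measure_def by blast
  \<comment> \<open>Taking \<open>\<epsilon> / 2\<close> here leaves a strict gap to the growth rate
    \<open>\<gamma> + \<epsilon>\<close> of \<mu>.\<close>
  also have "ennreal \<gamma> < ennreal (\<gamma> + \<epsilon> / 2)" using \<gamma> \<epsilon> by (intro ennreal_lessI) auto
  finally have "\<forall>\<^sub>F r in at_right 0. emeasure \<nu> (cball x r) / emeasure \<nu> (cball x (\<alpha> * r)) < ennreal (\<gamma> + \<epsilon> / 2)"
    by (rule Limsup_lessD)
  then obtain b where b: "b > 0"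
    "\<And>r. 0 < r \<Longrightarrow> r < b \<Longrightarrow> emeasure \<nu> (cball x r) / emeasure \<nu> (cball x (\<alpha> * r)) < ennreal (\<gamma> + \<epsilon> / 2)"
    by (auto simp: eventually_at_right_field)
  \<comment> \<open>All radii stay below \<open>R\<close> (finite \<mu>-measure), \<rho> (the
    requested bound) and \<open>b\<close> (validity of the ratio bound). For \<alpha> = 1 the
    sequence is constant and the argument is unchanged.\<close>
  define s where "s k = \<alpha> ^ k * (min R (min \<rho> b) / 2)" for k
  have s0: "0 < s k" for k using \<alpha> R \<rho> b by (simp add: s_def)
  have "s k \<le> 1 * (min R (min \<rho> b) / 2)" for k
    unfolding s_def using \<alpha> R \<rho> b by (intro mult_right_mono power_le_one) auto
  then have s: "s k < R \<and> s k < \<rho> \<and> s k < b" for k using R \<rho> b by (smt (verit) field_sum_of_halves)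
  have sS: "s (Suc k) = \<alpha> * s k" for k by (simp add: s_def)
  have \<nu>p: "0 < emeasure \<nu> (cball x r)" if "r > 0" for r
    using \<nu> that unfolding asymptotically_bounded_measure_def by blast
  have \<nu>f: "emeasure \<nu> (cball x r) = ennreal (measure \<nu> (cball x r))" for r
  proof (rule emeasure_eq_ennreal_measure)
    have "cball x r \<in> sets borel" "bounded (cball x r)" by auto
    then have "emeasure \<nu> (cball x r) < \<infinity>"
      using \<nu> unfolding asymptotically_bounded_measure_def by blast
    then show "emeasure \<nu> (cball x r) \<noteq> top" by simp
  qed
  have \<mu>f: "emeasure \<mu> (cball x (s k)) = ennreal (measure \<mu> (cball x (s k)))" for k
  proof (rule emeasure_eq_ennreal_measure)
    have "emeasure \<mu> (cball x (s k)) \<le> emeasure \<mu> (cball x R)"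
      using s[of k] sets by (intro emeasure_mono subset_cball) auto
    then show "emeasure \<mu> (cball x (s k)) \<noteq> top" using R(2) by (auto simp: top_unique)
  qed
  have \<nu>pos: "measure \<nu> (cball x r) > 0" if "r > 0" for r
    using \<nu>p[OF that] \<nu>f[of r] by simp
  have "\<exists>k. measure \<mu> (cball x (s k)) \<le> \<epsilon> * measure \<nu> (cball x (s k))"
  proof (rule geometric_domination[where g = "\<gamma> + \<epsilon>" and h = "\<gamma> + \<epsilon> / 2"])
    fix k
    have "ennreal (\<gamma> + \<epsilon>) * emeasure \<mu> (cball x (s (Suc k))) < emeasure \<mu> (cball x (s k))"
      using neg s s0 by (auto simp: sS not_le)
    then have "ennreal ((\<gamma> + \<epsilon>) * measure \<mu> (cball x (s (Suc k)))) < ennreal (measure \<mu> (cball x (s k)))"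
      using \<gamma> \<epsilon> by (simp add: \<mu>f ennreal_mult)
    then show "(\<gamma> + \<epsilon>) * measure \<mu> (cball x (s (Suc k))) \<le> measure \<mu> (cball x (s k))"
      using \<gamma> \<epsilon> by (subst (asm) ennreal_less_iff) auto
    have "emeasure \<nu> (cball x (s k)) / emeasure \<nu> (cball x (s (Suc k))) < ennreal (\<gamma> + \<epsilon> / 2)"
      using b(2)[OF s0[of k]] s[of k] by (simp add: sS)
    then have "ennreal (measure \<nu> (cball x (s k)) / measure \<nu> (cball x (s (Suc k)))) < ennreal (\<gamma> + \<epsilon> / 2)"
      using \<nu>pos[OF s0] by (simp add: \<nu>f divide_ennreal)
    then have "measure \<nu> (cball x (s k)) / measure \<nu> (cball x (s (Suc k))) < \<gamma> + \<epsilon> / 2"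
      by (subst (asm) ennreal_less_iff) auto
    then show "measure \<nu> (cball x (s k)) \<le> (\<gamma> + \<epsilon> / 2) * measure \<nu> (cball x (s (Suc k)))"
      using \<nu>pos[OF s0[of "Suc k"]] by (simp add: pos_divide_less_eq)
  qed (use \<gamma> \<epsilon> \<nu>pos[OF s0] in auto)
  then obtain k where "measure \<mu> (cball x (s k)) \<le> \<epsilon> * measure \<nu> (cball x (s k))" by blast
  then have "emeasure \<mu> (cball x (s k)) \<le> ennreal \<epsilon> * emeasure \<nu> (cball x (s k))"
    using \<epsilon> by (simp add: \<mu>f \<nu>f ennreal_mult[symmetric] ennreal_leI)
  then show False using neg s s0 by blast
qed

lemma sum_le_packing_premeasure:
  assumes "finite T" "disjoint_balls T" "\<And>x r. (x, r) \<in> T \<Longrightarrow> 0 < r \<and> r < \<delta> \<and> cball x r \<subseteq> U"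
  shows "(\<Sum>(x, r)\<in>T. q (cball x r)) \<le> packing_premeasure q \<delta> U"
proof -
  let ?b = "\<lambda>(x, r). cball x r"
  \<comment> \<open>Disjoint nonempty balls are distinct sets, so summing over pairs or over the
    packing gives the same value.\<close>
  have inj: "inj_on ?b T"
  proof (rule inj_onI, rule ccontr)
    fix p p' assume p: "p \<in> T" "p' \<in> T" "?b p = ?b p'" "p \<noteq> p'"
    have "?b p \<inter> ?b p' = {}"
      by (rule disjoint_family_onD[OF assms(2)[unfolded disjoint_balls_def] p(1,2,4)])
    moreover have "?b p \<noteq> {}" using assms(3) p(1) by (cases p) force
    ultimately show False using p(3) by simp
  qed
  have "disjoint (?b ` T)"
    using assms(2) unfolding disjoint_balls_def by (rule disjoint_family_on_disjoint_image)
  then have "packing U \<delta> (?b ` T)"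
    unfolding packing_def using assms(1,3) by (fastforce simp: countable_finite)
  then have "(\<Sum>\<^sub>\<infinity>B\<in>?b ` T. q B) \<le> packing_premeasure q \<delta> U"
    unfolding packing_premeasure_def by (intro SUP_upper) simp
  moreover have "(\<Sum>\<^sub>\<infinity>B\<in>?b ` T. q B) = (\<Sum>p\<in>T. q (?b p))"
    using assms(1) inj by (simp add: sum.reindex)
  ultimately show ?thesis by (simp add: case_prod_unfold)
qed

text \<open>A disjoint Vitali family of good balls nearly exhausts \<open>U\<close>. Passing from
  \<open>r\<close> to \<open>\<alpha> * r\<close> costs the factor \<gamma> + \<epsilon> and
  comparison with \<open>q\<close> the factor \<open>C\<close>; the balls controlled by \<nu>
  contribute at most \<open>\<epsilon> * \<nu> U\<close>, where \<open>\<nu> U\<close> is finite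
  because \<open>U\<close> is bounded.\<close>

lemma emeasure_le_packing_premeasure:
  fixes \<mu> \<nu> :: "'a::metric_space measure"
  assumes lim: "directionally_limited_at \<xi> \<eta> \<zeta> (UNIV :: 'a set)" and \<eta>: "\<eta> \<le> 1/3" and \<xi>: "\<xi> > 0"
    and D: "countable D" "closure D = (UNIV :: 'a set)"
    and \<nu>: "asymptotically_bounded_measure \<alpha> \<gamma> \<nu>" and \<alpha>: "0 < \<alpha>" "\<alpha> \<le> 1" and \<gamma>: "\<gamma> \<ge> 1"
    and C: "C \<ge> 1" and rad: "rad > 0" and \<delta>: "\<delta> > 0"
    and sets: "sets \<mu> = sets borel"
    and U: "open U" "bounded U" "emeasure \<mu> U < \<infinity>"
    and q: "\<And>x r. 0 < r \<Longrightarrow> r < rad \<Longrightarrow> ennreal (inverse C) * emeasure \<mu> (cball x (\<alpha> * r)) \<le> q (cball x r)"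
  shows "emeasure \<mu> U \<le> ennreal (\<gamma> * C) * packing_premeasure q \<delta> U"
proof (cases "packing_premeasure q \<delta> U = \<infinity>")
  case True
  then show ?thesis using \<gamma> C by (simp add: ennreal_mult_top)
next
  case False
  then obtain p where p: "packing_premeasure q \<delta> U = ennreal p" "p \<ge> 0"
    by (cases "packing_premeasure q \<delta> U") auto
  have s\<nu>: "sets \<nu> = sets borel" using \<nu> unfolding asymptotically_bounded_measure_def by blast
  have "U \<in> sets borel" using U by simp
  then have "emeasure \<nu> U < \<infinity>" using \<nu> U(2) unfolding asymptotically_bounded_measure_def by blast
  then obtain v where v: "emeasure \<nu> U = ennreal v" "v \<ge> 0" by (cases "emeasure \<nu> U") auto
  obtain m where m: "emeasure \<mu> U = ennreal m" "m \<ge> 0" using U(3) by (cases "emeasure \<mu> U") auto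
  have key: "m \<le> (\<gamma> + \<epsilon>) * C * p + \<epsilon> * v + \<epsilon>" if \<epsilon>: "\<epsilon> > 0" for \<epsilon>
  proof -
    \<comment> \<open>The bound by \<delta> makes the balls admissible for the packing, the bound by
      \<open>rad\<close> makes the comparison with \<open>q\<close> available.\<close>
    define P where "P x r \<longleftrightarrow> r < min \<delta> rad \<and>
      (emeasure \<mu> (cball x r) \<le> ennreal (\<gamma> + \<epsilon>) * emeasure \<mu> (cball x (\<alpha> * r)) \<or>
       emeasure \<mu> (cball x r) \<le> ennreal \<epsilon> * emeasure \<nu> (cball x r))" for x r
    have fine: "\<forall>x\<in>U. \<forall>\<rho>>0. \<exists>r. 0 < r \<and> r < \<rho> \<and> P x r"
    proof (intro ballI allI impI)
      fix x and \<rho> :: real assume x: "x \<in> U" and \<rho>: "\<rho> > 0"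
      obtain R where R: "R > 0" "cball x R \<subseteq> U" using U(1) x open_contains_cball by blast
      have "emeasure \<mu> (cball x R) \<le> emeasure \<mu> U" using R(2) U(1) sets by (intro emeasure_mono) auto
      then have "emeasure \<mu> (cball x R) < \<infinity>" using U(3) by (rule le_less_trans)
      moreover have "min \<rho> (min \<delta> rad) > 0" using \<rho> \<delta> rad by simp
      ultimately show "\<exists>r. 0 < r \<and> r < \<rho> \<and> P x r"
        using asymptotically_bounded_fine[OF \<nu> \<alpha> \<gamma> sets R(1) _ \<epsilon>, of x "min \<rho> (min \<delta> rad)"]
        unfolding P_def by auto
    qed
    from vitali_covering[OF lim \<eta> \<xi> D sets U(1,3) fine \<epsilon>]
    obtain T where T: "finite T" "disjoint_balls T"
      and T3: "\<forall>(x, r)\<in>T. 0 < r \<and> P x r \<and> cball x r \<subseteq> U"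
      and T4: "emeasure \<mu> U \<le> emeasure \<mu> (\<Union>(x, r)\<in>T. cball x r) + ennreal \<epsilon>"
      by (elim exE conjE)
    have T3: "0 < r \<and> P x r \<and> cball x r \<subseteq> U" if "(x, r) \<in> T" for x r using T3 that by blast
    let ?b = "\<lambda>(x, r). cball x r"
    have disj: "disjoint_family_on ?b T" using T(2) by (simp add: disjoint_balls_def)
    \<comment> \<open>Adding the bounds for both kinds gives one estimate for every ball, so
      \<open>T\<close> need not be split.\<close>
    have ball: "emeasure \<mu> (?b z) \<le> ennreal ((\<gamma> + \<epsilon>) * C) * q (?b z) + ennreal \<epsilon> * emeasure \<nu> (?b z)"
      if "z \<in> T" for z
    proof -
      obtain x r where z: "z = (x, r)" by (cases z)
      have r: "0 < r" "P x r" using T3[of x r] that z by simp_all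
      from r(2) consider
        "emeasure \<mu> (cball x r) \<le> ennreal (\<gamma> + \<epsilon>) * emeasure \<mu> (cball x (\<alpha> * r))"
        | "emeasure \<mu> (cball x r) \<le> ennreal \<epsilon> * emeasure \<nu> (cball x r)" unfolding P_def by blast
      then show ?thesis
      proof cases
        case 1
        have "emeasure \<mu> (cball x (\<alpha> * r)) = ennreal C * (ennreal (inverse C) * emeasure \<mu> (cball x (\<alpha> * r)))"
          using C by (simp add: mult.assoc[symmetric] ennreal_mult[symmetric])
        also have "\<dots> \<le> ennreal C * q (cball x r)"
          using r(1,2) unfolding P_def by (intro mult_left_mono q) auto
        finally have "ennreal (\<gamma> + \<epsilon>) * emeasure \<mu> (cball x (\<alpha> * r)) \<le> ennreal (\<gamma> + \<epsilon>) * (ennreal C * q (cball x r))"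
          by (rule mult_left_mono) simp
        also have "\<dots> = ennreal ((\<gamma> + \<epsilon>) * C) * q (cball x r)"
          using \<gamma> C \<epsilon> by (simp add: ennreal_mult mult.assoc)
        finally show ?thesis using 1 z by (auto intro: order_trans add_increasing2)
      next
        case 2
        then show ?thesis using z by (auto intro: add_increasing)
      qed
    qed
    have meas: "?b ` T \<subseteq> sets \<mu>" "?b ` T \<subseteq> sets \<nu>" unfolding sets s\<nu> by auto
    have "emeasure \<mu> (\<Union>z\<in>T. ?b z) = (\<Sum>z\<in>T. emeasure \<mu> (?b z))"
      by (rule sum_emeasure[OF meas(1) disj T(1), symmetric])
    also have "\<dots> \<le> (\<Sum>z\<in>T. ennreal ((\<gamma> + \<epsilon>) * C) * q (?b z) + ennreal \<epsilon> * emeasure \<nu> (?b z))"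
      by (intro sum_mono ball)
    also have "\<dots> = ennreal ((\<gamma> + \<epsilon>) * C) * (\<Sum>z\<in>T. q (?b z)) + ennreal \<epsilon> * (\<Sum>z\<in>T. emeasure \<nu> (?b z))"
      by (simp add: sum.distrib sum_distrib_left)
    also have "(\<Sum>z\<in>T. emeasure \<nu> (?b z)) = emeasure \<nu> (\<Union>z\<in>T. ?b z)"
      by (rule sum_emeasure[OF meas(2) disj T(1)])
    also have "\<dots> \<le> emeasure \<nu> U"
    proof (rule emeasure_mono)
      show "(\<Union>z\<in>T. ?b z) \<subseteq> U" using T3 by blast
      show "U \<in> sets \<nu>" using U(1) s\<nu> by simp
    qed
    also have "(\<Sum>z\<in>T. q (?b z)) \<le> packing_premeasure q \<delta> U"
    proof -
      have "\<And>x r. (x, r) \<in> T \<Longrightarrow> 0 < r \<and> r < \<delta> \<and> cball x r \<subseteq> U"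
        using T3 unfolding P_def by (meson min_less_iff_conj)
      from sum_le_packing_premeasure[OF T(1,2) this, of q] show ?thesis
        by (simp add: case_prod_unfold)
    qed
    finally have "emeasure \<mu> (\<Union>z\<in>T. ?b z) \<le> ennreal ((\<gamma> + \<epsilon>) * C) * ennreal p + ennreal \<epsilon> * ennreal v"
      using p v by (simp add: add_mono mult_left_mono)
    then have "emeasure \<mu> U \<le> ennreal ((\<gamma> + \<epsilon>) * C) * ennreal p + ennreal \<epsilon> * ennreal v + ennreal \<epsilon>"
      using T4 by (meson add_right_mono order_trans)
    also have "\<dots> = ennreal ((\<gamma> + \<epsilon>) * C * p + \<epsilon> * v + \<epsilon>)"
      using \<gamma> C \<epsilon> p(2) v(2) by (simp add: ennreal_mult ennreal_plus)
    finally show ?thesis unfolding m using \<gamma> C \<epsilon> p(2) v(2) by (subst (asm) ennreal_le_iff) auto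
  qed
  \<comment> \<open>The values \<open>p\<close> and \<open>v\<close> do not depend on \<epsilon>, so
    \<epsilon> tends to 0 with \<delta> and \<nu> fixed.\<close>
  have "((\<lambda>\<epsilon>. (\<gamma> + \<epsilon>) * C * p + \<epsilon> * v + \<epsilon>) \<longlongrightarrow> (\<gamma> + 0) * C * p + 0 * v + 0) (at_right 0)"
    by (intro tendsto_intros)
  then have "m \<le> (\<gamma> + 0) * C * p + 0 * v + 0"
    by (rule tendsto_lowerbound) (auto simp: eventually_at_right_field intro!: exI[of _ 1] key)
  then show ?thesis unfolding m p using \<gamma> C p(2) by (simp add: ennreal_mult[symmetric] ennreal_leI)
qed

theorem corollary3p10:
  fixes \<alpha> \<gamma> C rad :: "nat \<Rightarrow> real"
    and \<nu> :: "nat \<Rightarrow> 'a::metric_space measure"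
    and \<mu> :: "'a measure"
    and q :: "'a set \<Rightarrow> ennreal"
  assumes "\<And>n. 0 < \<alpha> n \<and> \<alpha> n \<le> 1"
    and "\<And>n. \<gamma> n \<ge> 1"
    and "\<And>n. C n \<ge> 1"
    and "\<And>n. rad n > 0"
    and "\<alpha> \<longlonglongrightarrow> 1" and "\<gamma> \<longlonglongrightarrow> 1" and "C \<longlonglongrightarrow> 1" and "rad \<longlonglongrightarrow> 0"
    and "separable_space (euclidean :: 'a topology)"
    and "directionally_limited TYPE('a)"
    and "\<And>n. asymptotically_bounded_measure (\<alpha> n) (\<gamma> n) (\<nu> n)"
    and "sets \<mu> = sets borel"
    and "locally_finite_measure \<mu>"
    and "premeasure q"
    and "\<And>x n r. 0 < r \<Longrightarrow> r < rad n \<Longrightarrow>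
           ennreal (inverse (C n)) * emeasure \<mu> (cball x (\<alpha> n * r)) \<le> q (cball x r) \<and>
           q (cball x r) \<le> ennreal (C n) * emeasure \<mu> (cball x r)"
  shows "\<forall>A\<in>sets borel. packing_measure q A = emeasure \<mu> A"
proof
  fix A :: "'a set" assume A: "A \<in> sets borel"
  note \<alpha> = assms(1) and \<gamma> = assms(2) and C = assms(3) and rad = assms(4)
    and lims = assms(6,7) and \<nu> = assms(11) and sets = assms(12) and lf = assms(13) and q = assms(15)
  obtain D :: "'a set" where D: "countable D" "closure D = UNIV"
    using assms(9) unfolding separable_space_def by auto
  obtain \<xi> \<eta> \<zeta> where lim: "\<xi> > 0" "\<eta> \<le> 1/3" "directionally_limited_at \<xi> \<eta> \<zeta> (UNIV :: 'a set)"
    using assms(10) unfolding directionally_limited_def by blast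
  obtain G :: "nat \<Rightarrow> 'a set" where G: "\<And>i. open (G i)" "\<And>i. bounded (G i)"
    "\<And>i. emeasure \<mu> (G i) < \<infinity>" "(\<Union>i. G i) = UNIV"
    using locally_finite_open_cover[OF sets lf D] by metis
  \<comment> \<open>Packings of order \<open>rad n\<close> consist of balls to which the upper
    comparison with constant \<open>C n\<close> applies; disjointness sums it up, and then
    \<open>n\<close> tends to infinity.\<close>
  have upper: "packing_open q U \<le> emeasure \<mu> U" if U: "open U" for U
  proof -
    have le: "packing_open q U \<le> ennreal (C n) * emeasure \<mu> U" for n
    proof -
      have "(\<Sum>\<^sub>\<infinity>B\<in>\<F>. q B) \<le> ennreal (C n) * emeasure \<mu> U" if \<F>: "packing U (rad n) \<F>" for \<F>
      proof -
        have cl: "B \<in> sets \<mu> \<and> q B \<le> ennreal (C n) * emeasure \<mu> B" if "B \<in> \<F>" for B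
          using \<F> that q sets unfolding packing_def by force
        have "sum q T \<le> ennreal (C n) * emeasure \<mu> U" if T: "finite T" "T \<subseteq> \<F>" for T
        proof -
          have "sum q T \<le> (\<Sum>B\<in>T. ennreal (C n) * emeasure \<mu> B)" using cl T by (intro sum_mono) auto
          also have "\<dots> = ennreal (C n) * (\<Sum>B\<in>T. emeasure \<mu> B)" by (simp add: sum_distrib_left)
          also have "(\<Sum>B\<in>T. emeasure \<mu> B) = emeasure \<mu> (\<Union>B\<in>T. B)"
          proof (rule sum_emeasure[OF _ _ T(1)])
            show "(\<lambda>B. B) ` T \<subseteq> sets \<mu>" using cl T(2) by blast
            have "disjoint \<F>" using \<F> by (simp add: packing_def)
            then show "disjoint_family_on (\<lambda>B. B) T"
              unfolding disjoint_family_on_def using T(2) by (meson disjointD subsetD)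
          qed
          also have "\<dots> \<le> emeasure \<mu> U"
          proof (rule emeasure_mono)
            have "\<Union>\<F> \<subseteq> U" using \<F> by (simp add: packing_def)
            then show "(\<Union>B\<in>T. B) \<subseteq> U" using T(2) by blast
            show "U \<in> sets \<mu>" using U sets by simp
          qed
          finally show ?thesis by (simp add: mult_left_mono)
        qed
        then show ?thesis by (subst nonneg_infsum_complete) (auto intro!: SUP_least)
      qed
      then have "packing_premeasure q (rad n) U \<le> ennreal (C n) * emeasure \<mu> U"
        unfolding packing_premeasure_def by (intro SUP_least) simp
      then show ?thesis
        unfolding packing_open_def using rad[of n] by (intro INF_lower2[of "rad n"]) auto
    qed
    show ?thesis
    proof (cases "emeasure \<mu> U")
      case (real m)
      have "(\<lambda>n. ennreal (C n * m)) \<longlonglongrightarrow> ennreal (1 * m)"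
        using lims(2) by (intro tendsto_intros)
      moreover have "packing_open q U \<le> ennreal (C n * m)" for n
        using le[of n] real C[of n] by (simp add: ennreal_mult)
      ultimately show ?thesis using real by (intro LIMSEQ_le_const) auto
    qed simp
  qed
  have lower: "emeasure \<mu> U \<le> packing_open q U" if U: "open U" for U
  proof -
    \<comment> \<open>Here \<delta> is fixed while \<open>n\<close> tends to infinity: the measure
      \<nu> \<open>n\<close> has already disappeared from the bound, and its constants
      \<open>\<gamma> n * C n\<close> tend to 1.\<close>
    have bounded_case: "emeasure \<mu> V \<le> packing_open q V"
      if V: "open V" "bounded V" "emeasure \<mu> V < \<infinity>" for V
      unfolding packing_open_def
    proof (rule INF_greatest)
      fix \<delta> :: real assume "\<delta> \<in> {0<..}"
      then have \<delta>: "\<delta> > 0" by simp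
      have le: "emeasure \<mu> V \<le> ennreal (\<gamma> n * C n) * packing_premeasure q \<delta> V" for n
        by (rule emeasure_le_packing_premeasure[OF lim(3,2,1) D \<nu> _ _ \<gamma> C rad \<delta> sets V])
          (use \<alpha>[of n] q in auto)
      show "emeasure \<mu> V \<le> packing_premeasure q \<delta> V"
      proof (cases "packing_premeasure q \<delta> V")
        case (real p)
        have "(\<lambda>n. ennreal (\<gamma> n * C n * p)) \<longlonglongrightarrow> ennreal (1 * 1 * p)"
          using lims by (intro tendsto_intros)
        moreover have "emeasure \<mu> V \<le> ennreal (\<gamma> n * C n * p)" for n
          using le[of n] real C[of n] \<gamma>[of n] by (simp add: ennreal_mult)
        ultimately show ?thesis using real by (intro LIMSEQ_le_const) auto
      qed simp
    qed
    \<comment> \<open>An increasing exhaustion of \<open>U\<close> by bounded open sets of finite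
      measure extends the bound to all open sets, also those of infinite measure.\<close>
    define W where "W n = U \<inter> (\<Union>i\<le>n. G i)" for n
    have W: "open (W n)" "bounded (W n)" for n
      unfolding W_def using U G(1,2) by (auto intro!: open_Int bounded_Int)
    have Wf: "emeasure \<mu> (W n) < \<infinity>" for n
    proof -
      have "emeasure \<mu> (W n) \<le> emeasure \<mu> (\<Union>i\<le>n. G i)"
        unfolding W_def using G(1) sets by (intro emeasure_mono) auto
      also have "\<dots> \<le> (\<Sum>i\<le>n. emeasure \<mu> (G i))"
        using G(1) sets by (intro emeasure_subadditive_finite) auto
      also have "\<dots> < \<infinity>" using G(3) by (simp add: less_top)
      finally show ?thesis .
    qed
    have "(SUP n. emeasure \<mu> (W n)) = emeasure \<mu> (\<Union>n. W n)"
    proof (rule SUP_emeasure_incseq)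
      show "range W \<subseteq> sets \<mu>" using W(1) sets by auto
      show "incseq W" unfolding incseq_def W_def by fastforce
    qed
    also have "(\<Union>n. W n) = U"
    proof -
      have "(\<Union>n. W n) = U \<inter> (\<Union>i. G i)" unfolding W_def by auto
      then show ?thesis using G(4) by simp
    qed
    finally have "emeasure \<mu> U = (SUP n. emeasure \<mu> (W n))" ..
    also have "\<dots> \<le> packing_open q U"
    proof (rule SUP_least)
      fix n
      have "emeasure \<mu> (W n) \<le> packing_open q (W n)" by (rule bounded_case[OF W Wf])
      also have "\<dots> \<le> packing_open q U"
        unfolding packing_open_def
        by (intro INF_mono) (auto simp: W_def intro: packing_premeasure_mono)
      finally show "emeasure \<mu> (W n) \<le> packing_open q U" .
    qed
    finally show ?thesis .
  qed
  \<comment> \<open>Both sides now agree on open sets. Outer regularity of \<mu> gives one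
    inequality for Borel sets, monotonicity of \<mu> the other.\<close>
  show "packing_measure q A = emeasure \<mu> A"
  proof (rule antisym)
    show "packing_measure q A \<le> emeasure \<mu> A"
    proof (rule ennreal_le_epsilon)
      fix e :: real assume "e > 0"
      then obtain V where V: "open V" "A \<subseteq> V" "emeasure \<mu> V \<le> emeasure \<mu> A + ennreal e"
        using sigma_finite_open_outer_approx[OF sets G(1,3,4) A] by metis
      have "packing_measure q A \<le> packing_open q V"
        unfolding packing_measure_def using V by (intro INF_lower) auto
      also have "\<dots> \<le> emeasure \<mu> A + ennreal e" using upper[OF V(1)] V(3) by (rule order_trans)
      finally show "packing_measure q A \<le> emeasure \<mu> A + ennreal e" .
    qed
    show "emeasure \<mu> A \<le> packing_measure q A"
      unfolding packing_measure_def
    proof (rule INF_greatest)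
      fix U assume "U \<in> {U. open U \<and> A \<subseteq> U}"
      then have U: "open U" "A \<subseteq> U" by auto
      then have "emeasure \<mu> A \<le> emeasure \<mu> U" using sets by (intro emeasure_mono) auto
      also have "\<dots> \<le> packing_open q U" by (rule lower[OF U(1)])
      finally show "emeasure \<mu> A \<le> packing_open q U" .
    qed
  qed
qed

end
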